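(* Let $\mathcal M$ be a Riemannian manifold and let $F:\mathcal M\to\mathbb R$ be an $L$-smooth and $\mu$-strongly g-convex function, with a minimizer $x^\ast$. Suppose we have an algorithm $\mathcal A_{\mathrm{ns}}$ to minimize $F$, such that for any starting point $x_0$ with $d(x_0,x^\ast)\le R$ it produces a point $\hat x_T$ in time $T=\mathrm{Time}_{\mathrm{ns}}(L,\mu,R)$ satisfying $F(\hat x_T)-F(x^\ast)\le\mu R^2/4$. Then we can compute an $\varepsilon$-minimizer of $F$ in time $$O\big(\mathrm{Time}_{\mathrm{ns}}(L,\mu,R)\,\log(\mu/\varepsilon)\big).$$
   Context: $d$ is the Riemannian distance and $\mathcal M$ is uniquely geodesic, so that $\exp_x^{-1}$ is well defined. A differentiable $F$ is $L$-smooth if $F(y)\le F(x)+\langle\nabla F(x),\exp_x^{-1}(y)\rangle+\frac L2d(x,y)^2$, and $\mu$-strongly g-convex ($\mu>0$) if $F(y)\ge F(x)+\langle\nabla F(x),\exp_x^{-1}(y)\rangle+\frac\mu2d(x,y)^2$, for all $x,y\in\mathcal M$. An $\varepsilon$-minimizer is a point $\hat x$ with $F(\hat x)-F(x^\ast)\le\varepsilon$. $\mathrm{Time}_{\mathrm{ns}}(L,\mu,R)$ denotes the time $\mathcal A_{\mathrm{ns}}$ requires for the stated task with parameters $L,\mu,R$.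
   Formalization: The guarantee on A_ns is assumed for every radius r in (0,R], and Time_ns(L,μ,·) is assumed nondecreasing on (0,R], without which the claim fails; the O-bound holds once μ/ε exceeds a threshold depending on R; dimension at least 1. *)

theory Defs
  imports "HOL-Analysis.Analysis"
begin

section \<open>Smooth maps between Euclidean spaces\<close>

text \<open>For maps on an open subset of a finite-dimensional space, being \<open>k\<close> times continuously
  differentiable amounts to continuity of all iterated directional derivatives up to order \<open>k\<close>.\<close>

primrec Ck_on :: "nat \<Rightarrow> 'a::euclidean_space set \<Rightarrow> ('a \<Rightarrow> 'b::real_normed_vector) \<Rightarrow> bool" where
  "Ck_on 0 S f \<longleftrightarrow> continuous_on S f"
| "Ck_on (Suc k) S f \<longleftrightarrow>
     (\<forall>x\<in>S. f differentiable (at x)) \<and> (\<forall>v. Ck_on k S (\<lambda>x. frechet_derivative f (at x) v))"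

definition smooth_on :: "'a::euclidean_space set \<Rightarrow> ('a \<Rightarrow> 'b::real_normed_vector) \<Rightarrow> bool" where
  "smooth_on S f \<longleftrightarrow> (\<forall>k. Ck_on k S f)"

section \<open>Riemannian manifolds\<close>

text \<open>The points of the manifold are the elements of a type \<open>'m\<close>, the model space is \<open>'e\<close>.
  A chart is a pair of its domain and its coordinate map (irrelevant outside the domain).\<close>

type_synonym ('m, 'e) chart = "'m set \<times> ('m \<Rightarrow> 'e)"

definition chart_inv :: "('m, 'e) chart \<Rightarrow> 'e \<Rightarrow> 'm" where
  "chart_inv c = inv_into (fst c) (snd c)"

definition transition :: "('m, 'e) chart \<Rightarrow> ('m, 'e) chart \<Rightarrow> 'e \<Rightarrow> 'e" where
  "transition c c' = snd c' \<circ> chart_inv c"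

definition transition_deriv ::
    "('m, 'e::euclidean_space) chart \<Rightarrow> ('m, 'e) chart \<Rightarrow> 'm \<Rightarrow> 'e \<Rightarrow> 'e" where
  "transition_deriv c c' p = frechet_derivative (transition c c') (at (snd c p))"

locale smooth_manifold =
  fixes A :: "('m::{t2_space, second_countable_topology}, 'e::euclidean_space) chart set"
  assumes chart_domain_open: "c \<in> A \<Longrightarrow> open (fst c)"
    and chart_image_open: "c \<in> A \<Longrightarrow> open (snd c ` fst c)"
    and chart_homeomorphism:
      "c \<in> A \<Longrightarrow> homeomorphism (fst c) (snd c ` fst c) (snd c) (chart_inv c)"
    and charts_cover: "(\<Union>c\<in>A. fst c) = UNIV"
    and charts_compatible:
      "c \<in> A \<Longrightarrow> c' \<in> A \<Longrightarrow> smooth_on (snd c ` (fst c \<inter> fst c')) (transition c c')"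

text \<open>\<open>g c p v w\<close> is the inner product at \<open>p\<close> of the tangent vectors whose coordinates in the
  chart \<open>c\<close> are \<open>v\<close> and \<open>w\<close>. Connectedness is not required here: it follows from the existence
  of geodesics between any two points.\<close>

type_synonym ('m, 'e) metric = "('m, 'e) chart \<Rightarrow> 'm \<Rightarrow> 'e \<Rightarrow> 'e \<Rightarrow> real"

locale riemannian_manifold = smooth_manifold A
  for A :: "('m::{t2_space, second_countable_topology}, 'e::euclidean_space) chart set" +
  fixes g :: "('m, 'e) metric"
  assumes metric_bilinear: "c \<in> A \<Longrightarrow> p \<in> fst c \<Longrightarrow> bilinear (g c p)"
    and metric_sym: "c \<in> A \<Longrightarrow> p \<in> fst c \<Longrightarrow> g c p v w = g c p w v"
    and metric_pos: "c \<in> A \<Longrightarrow> p \<in> fst c \<Longrightarrow> v \<noteq> 0 \<Longrightarrow> g c p v v > 0"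
    and metric_smooth: "c \<in> A \<Longrightarrow> smooth_on (snd c ` fst c) (\<lambda>u. g c (chart_inv c u) v w)"
    and metric_change: "c \<in> A \<Longrightarrow> c' \<in> A \<Longrightarrow> p \<in> fst c \<Longrightarrow> p \<in> fst c' \<Longrightarrow>
      g c p v w = g c' p (transition_deriv c c' p v) (transition_deriv c c' p w)"

section \<open>Tangent vectors and gradients\<close>

text \<open>A tangent vector at \<open>p\<close> is the family of its coordinate vectors in the charts around \<open>p\<close>,
  related by the derivatives of the transition maps (and \<open>0\<close> at all other arguments).\<close>

type_synonym ('m, 'e) tangent = "('m, 'e) chart \<Rightarrow> 'e"

definition tangent_space ::
    "('m, 'e::euclidean_space) chart set \<Rightarrow> 'm \<Rightarrow> ('m, 'e) tangent set" where
  "tangent_space A p = {v.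
     (\<forall>c\<in>A. \<forall>c'\<in>A. p \<in> fst c \<longrightarrow> p \<in> fst c' \<longrightarrow> v c' = transition_deriv c c' p (v c)) \<and>
     (\<forall>c. c \<notin> A \<or> p \<notin> fst c \<longrightarrow> v c = 0)}"

text \<open>The inner product and the differential below do not depend on the choice of the chart.\<close>

definition chart_at :: "('m, 'e) chart set \<Rightarrow> 'm \<Rightarrow> ('m, 'e) chart" where
  "chart_at A p = (SOME c. c \<in> A \<and> p \<in> fst c)"

definition inner_at ::
    "('m, 'e) chart set \<Rightarrow> ('m, 'e) metric \<Rightarrow> 'm \<Rightarrow> ('m, 'e) tangent \<Rightarrow> ('m, 'e) tangent \<Rightarrow> real" where
  "inner_at A g p v w = g (chart_at A p) p (v (chart_at A p)) (w (chart_at A p))"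

definition norm_at ::
    "('m, 'e) chart set \<Rightarrow> ('m, 'e) metric \<Rightarrow> 'm \<Rightarrow> ('m, 'e) tangent \<Rightarrow> real" where
  "norm_at A g p v = sqrt (inner_at A g p v v)"

definition differentiable_fun ::
    "('m, 'e::euclidean_space) chart set \<Rightarrow> ('m \<Rightarrow> real) \<Rightarrow> bool" where
  "differentiable_fun A F \<longleftrightarrow>
     (\<forall>c\<in>A. \<forall>p\<in>fst c. (F \<circ> chart_inv c) differentiable (at (snd c p)))"

definition differential ::
    "('m, 'e::euclidean_space) chart set \<Rightarrow> ('m \<Rightarrow> real) \<Rightarrow> 'm \<Rightarrow> ('m, 'e) tangent \<Rightarrow> real" where
  "differential A F p v =
     (let c = chart_at A p in frechet_derivative (F \<circ> chart_inv c) (at (snd c p)) (v c))"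

definition gradient ::
    "('m, 'e::euclidean_space) chart set \<Rightarrow> ('m, 'e) metric \<Rightarrow> ('m \<Rightarrow> real) \<Rightarrow> 'm \<Rightarrow> ('m, 'e) tangent" where
  "gradient A g F p = (THE v. v \<in> tangent_space A p \<and>
     (\<forall>w\<in>tangent_space A p. inner_at A g p v w = differential A F p w))"

section \<open>Curves, Riemannian distance, geodesics and the exponential map\<close>

definition velocity ::
    "('m, 'e::euclidean_space) chart set \<Rightarrow> (real \<Rightarrow> 'm) \<Rightarrow> real set \<Rightarrow> real \<Rightarrow> ('m, 'e) tangent" where
  "velocity A \<gamma> I t = (\<lambda>c. if c \<in> A \<and> \<gamma> t \<in> fst c
     then vector_derivative (snd c \<circ> \<gamma>) (at t within I) else 0)"

definition c1_curve ::
    "('m::topological_space, 'e::euclidean_space) chart set \<Rightarrow> (real \<Rightarrow> 'm) \<Rightarrow> real \<Rightarrow> real \<Rightarrow> bool" where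
  "c1_curve A \<gamma> a b \<longleftrightarrow> continuous_on {a..b} \<gamma> \<and>
     (\<forall>c\<in>A. (\<forall>t\<in>{a..b}. \<gamma> t \<in> fst c \<longrightarrow> (snd c \<circ> \<gamma>) differentiable (at t within {a..b})) \<and>
       continuous_on {t\<in>{a..b}. \<gamma> t \<in> fst c}
         (\<lambda>t. vector_derivative (snd c \<circ> \<gamma>) (at t within {a..b})))"

text \<open>Each piece has to be \<open>C\<^sup>1\<close> up to both of its endpoints, so that the speed is integrable.\<close>

definition piecewise_c1_curve ::
    "('m::topological_space, 'e::euclidean_space) chart set \<Rightarrow> (real \<Rightarrow> 'm) \<Rightarrow> bool" where
  "piecewise_c1_curve A \<gamma> \<longleftrightarrow> (\<exists>S. finite S \<and> {0, 1} \<subseteq> S \<and> S \<subseteq> {0..1} \<and>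
     (\<forall>a\<in>S. \<forall>b\<in>S. a < b \<and> S \<inter> {a<..<b} = {} \<longrightarrow> c1_curve A \<gamma> a b))"

definition curve_length ::
    "('m, 'e::euclidean_space) chart set \<Rightarrow> ('m, 'e) metric \<Rightarrow> (real \<Rightarrow> 'm) \<Rightarrow> real" where
  "curve_length A g \<gamma> = integral {0..1} (\<lambda>t. norm_at A g (\<gamma> t) (velocity A \<gamma> {0..1} t))"

definition riem_dist ::
    "('m::topological_space, 'e::euclidean_space) chart set \<Rightarrow> ('m, 'e) metric \<Rightarrow> 'm \<Rightarrow> 'm \<Rightarrow> real" where
  "riem_dist A g x y =
     Inf {curve_length A g \<gamma> |\<gamma>. piecewise_c1_curve A \<gamma> \<and> \<gamma> 0 = x \<and> \<gamma> 1 = y}"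

text \<open>Geodesics are the locally distance-minimizing curves of constant speed, here parametrized
  over the unit interval.\<close>

definition geodesic ::
    "('m::topological_space, 'e::euclidean_space) chart set \<Rightarrow> ('m, 'e) metric \<Rightarrow> (real \<Rightarrow> 'm) \<Rightarrow> bool" where
  "geodesic A g \<gamma> \<longleftrightarrow> c1_curve A \<gamma> 0 1 \<and>
     (\<exists>v\<ge>0. \<forall>t\<in>{0..1}. \<exists>\<delta>>0. \<forall>r\<in>{0..1} \<inter> ball t \<delta>. \<forall>s\<in>{0..1} \<inter> ball t \<delta>.
        riem_dist A g (\<gamma> r) (\<gamma> s) = v * \<bar>r - s\<bar>)"

definition uniquely_geodesic ::
    "('m::topological_space, 'e::euclidean_space) chart set \<Rightarrow> ('m, 'e) metric \<Rightarrow> bool" where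
  "uniquely_geodesic A g \<longleftrightarrow> (\<forall>x y.
     (\<exists>\<gamma>. geodesic A g \<gamma> \<and> \<gamma> 0 = x \<and> \<gamma> 1 = y) \<and>
     (\<forall>\<gamma> \<eta>. geodesic A g \<gamma> \<and> \<gamma> 0 = x \<and> \<gamma> 1 = y \<and> geodesic A g \<eta> \<and> \<eta> 0 = x \<and> \<eta> 1 = y
        \<longrightarrow> (\<forall>t\<in>{0..1}. \<gamma> t = \<eta> t)))"

text \<open>\<open>exp_maps_to A g x v y\<close> says that \<open>exp\<^sub>x v\<close> is defined and equal to \<open>y\<close>; the exponential
  map may be partial.\<close>

definition exp_maps_to ::
    "('m::topological_space, 'e::euclidean_space) chart set \<Rightarrow> ('m, 'e) metric \<Rightarrow>
      'm \<Rightarrow> ('m, 'e) tangent \<Rightarrow> 'm \<Rightarrow> bool" where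
  "exp_maps_to A g x v y \<longleftrightarrow>
     (\<exists>\<gamma>. geodesic A g \<gamma> \<and> \<gamma> 0 = x \<and> velocity A \<gamma> {0..1} 0 = v \<and> \<gamma> 1 = y)"

definition exp_inv ::
    "('m::topological_space, 'e::euclidean_space) chart set \<Rightarrow> ('m, 'e) metric \<Rightarrow>
      'm \<Rightarrow> 'm \<Rightarrow> ('m, 'e) tangent" where
  "exp_inv A g x y = (THE v. exp_maps_to A g x v y)"

section \<open>Function classes\<close>

definition L_smooth ::
    "('m::topological_space, 'e::euclidean_space) chart set \<Rightarrow> ('m, 'e) metric \<Rightarrow>
      real \<Rightarrow> ('m \<Rightarrow> real) \<Rightarrow> bool" where
  "L_smooth A g L F \<longleftrightarrow> differentiable_fun A F \<and>
     (\<forall>x y. F y \<le> F x + inner_at A g x (gradient A g F x) (exp_inv A g x y)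
        + L / 2 * (riem_dist A g x y)\<^sup>2)"

definition strongly_g_convex ::
    "('m::topological_space, 'e::euclidean_space) chart set \<Rightarrow> ('m, 'e) metric \<Rightarrow>
      real \<Rightarrow> ('m \<Rightarrow> real) \<Rightarrow> bool" where
  "strongly_g_convex A g \<mu> F \<longleftrightarrow> \<mu> > 0 \<and> differentiable_fun A F \<and>
     (\<forall>x y. F y \<ge> F x + inner_at A g x (gradient A g F x) (exp_inv A g x y)
        + \<mu> / 2 * (riem_dist A g x y)\<^sup>2)"

definition minimizer :: "('m \<Rightarrow> real) \<Rightarrow> 'm \<Rightarrow> bool" where
  "minimizer F x \<longleftrightarrow> (\<forall>y. F x \<le> F y)"

section \<open>First-order algorithms and their running time\<close>

text \<open>Algorithms are programs of a real RAM with registers for reals, points and tangent vectors.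
  They access the objective function only through first-order queries. The parameter \<open>'o\<close> is a
  set of names for further unit-cost local operations (say: exponential map, inner product,
  parallel transport), whose meaning is given by an arbitrary map \<open>sem\<close> on memories that does not
  see the objective function.\<close>

record ('m, 'e) memory =
  rreg :: "nat \<Rightarrow> real"
  preg :: "nat \<Rightarrow> 'm"
  vreg :: "nat \<Rightarrow> ('m, 'e) tangent"

datatype arith = Add | Sub | Mul | Div

fun arith_fun :: "arith \<Rightarrow> real \<Rightarrow> real \<Rightarrow> real" where
  "arith_fun Add x y = x + y"
| "arith_fun Sub x y = x - y"
| "arith_fun Mul x y = x * y"
| "arith_fun Div x y = x / y"

datatype 'o com =
    Const nat real
  | Arith arith nat nat nat
  | CopyPoint nat nat
  | Local 'o
  | Query nat nat nat
  | Seq "'o com" "'o com"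
  | IfLess nat nat "'o com" "'o com"
  | WhileLess nat nat "'o com"
  | Call "'o com" "nat list" nat nat

definition init_memory :: "real list \<Rightarrow> 'm \<Rightarrow> ('m, 'e::zero) memory" where
  "init_memory as x =
     \<lparr>rreg = (\<lambda>i. if i < length as then as ! i else 0), preg = (\<lambda>_. x), vreg = (\<lambda>_ _. 0)\<rparr>"

text \<open>\<open>exec sem orc c s t s'\<close>: started in \<open>s\<close>, the program \<open>c\<close> halts in \<open>s'\<close> after \<open>t\<close> time units.
  Every instruction and every evaluation of a test takes one unit. \<open>Call c is j k\<close> runs \<open>c\<close> in a
  fresh memory, passing the real registers \<open>is\<close> and the point register \<open>j\<close> as inputs, and
  stores the resulting point in point register \<open>k\<close>; the steps of the callee and the passing of
  the arguments are charged.\<close>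

inductive exec ::
    "('o \<Rightarrow> ('m, 'e::zero) memory \<Rightarrow> ('m, 'e) memory) \<Rightarrow> ('m \<Rightarrow> real \<times> ('m, 'e) tangent) \<Rightarrow>
      'o com \<Rightarrow> ('m, 'e) memory \<Rightarrow> nat \<Rightarrow> ('m, 'e) memory \<Rightarrow> bool"
  for sem orc where
  exec_Const: "exec sem orc (Const i a) s 1 (s\<lparr>rreg := (rreg s)(i := a)\<rparr>)"
| exec_Arith: "exec sem orc (Arith f i j k) s 1
     (s\<lparr>rreg := (rreg s)(i := arith_fun f (rreg s j) (rreg s k))\<rparr>)"
| exec_CopyPoint: "exec sem orc (CopyPoint i j) s 1 (s\<lparr>preg := (preg s)(i := preg s j)\<rparr>)"
| exec_Local: "exec sem orc (Local f) s 1 (sem f s)"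
| exec_Query: "orc (preg s i) = (a, v) \<Longrightarrow>
     exec sem orc (Query i j k) s 1
       (s\<lparr>rreg := (rreg s)(j := a), vreg := (vreg s)(k := v)\<rparr>)"
| exec_Seq: "exec sem orc c s t s' \<Longrightarrow> exec sem orc d s' u s'' \<Longrightarrow>
     exec sem orc (Seq c d) s (t + u) s''"
| exec_IfTrue: "rreg s i < rreg s j \<Longrightarrow> exec sem orc c s t s' \<Longrightarrow>
     exec sem orc (IfLess i j c d) s (1 + t) s'"
| exec_IfFalse: "\<not> rreg s i < rreg s j \<Longrightarrow> exec sem orc d s t s' \<Longrightarrow>
     exec sem orc (IfLess i j c d) s (1 + t) s'"
| exec_WhileFalse: "\<not> rreg s i < rreg s j \<Longrightarrow> exec sem orc (WhileLess i j c) s 1 s"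
| exec_WhileTrue: "rreg s i < rreg s j \<Longrightarrow> exec sem orc c s t s' \<Longrightarrow>
     exec sem orc (WhileLess i j c) s' u s'' \<Longrightarrow>
     exec sem orc (WhileLess i j c) s (1 + t + u) s''"
| exec_Call: "exec sem orc c (init_memory (map (rreg s) is) (preg s j)) t s' \<Longrightarrow>
     exec sem orc (Call c is j k) s (1 + length is + t)
       (s\<lparr>preg := (preg s)(k := preg s' 0)\<rparr>)"

definition first_order_oracle ::
    "('m, 'e::euclidean_space) chart set \<Rightarrow> ('m, 'e) metric \<Rightarrow> ('m \<Rightarrow> real) \<Rightarrow>
      'm \<Rightarrow> real \<times> ('m, 'e) tangent" where
  "first_order_oracle A g F x = (F x, gradient A g F x)"

text \<open>On objective \<open>F\<close> with real inputs \<open>as\<close> and starting point \<open>x\<close>, the algorithm \<open>c\<close> outputs the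
  point \<open>y\<close> (found in point register \<open>0\<close>) in time \<open>t\<close>.\<close>

definition outputs ::
    "('m, 'e::euclidean_space) chart set \<Rightarrow> ('m, 'e) metric \<Rightarrow>
      ('o \<Rightarrow> ('m, 'e) memory \<Rightarrow> ('m, 'e) memory) \<Rightarrow> ('m \<Rightarrow> real) \<Rightarrow>
      'o com \<Rightarrow> real list \<Rightarrow> 'm \<Rightarrow> nat \<Rightarrow> 'm \<Rightarrow> bool" where
  "outputs A g sem F c as x t y \<longleftrightarrow>
     (\<exists>s. exec sem (first_order_oracle A g F) c (init_memory as x) t s \<and> preg s 0 = y)"

definition solves_task ::
    "('m::topological_space, 'e::euclidean_space) chart set \<Rightarrow> ('m, 'e) metric \<Rightarrow>
      ('o \<Rightarrow> ('m, 'e) memory \<Rightarrow> ('m, 'e) memory) \<Rightarrow> ('m \<Rightarrow> real) \<Rightarrow> 'm \<Rightarrow>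
      'o com \<Rightarrow> real \<Rightarrow> real \<Rightarrow> real \<Rightarrow> real \<Rightarrow> bool" where
  "solves_task A g sem F xstar c L \<mu> r T \<longleftrightarrow>
     (\<forall>x0. riem_dist A g x0 xstar \<le> r \<longrightarrow>
        (\<exists>t xT. outputs A g sem F c [L, \<mu>, r] x0 t xT \<and> real t \<le> T \<and>
           F xT - F xstar \<le> \<mu> * r\<^sup>2 / 4))"

definition eps_minimizer :: "('m \<Rightarrow> real) \<Rightarrow> 'm \<Rightarrow> real \<Rightarrow> 'm \<Rightarrow> bool" where
  "eps_minimizer F xstar \<epsilon> x \<longleftrightarrow> F x - F xstar \<le> \<epsilon>"

end

theory Submission
  imports Defs
begin

text \<open>
  At the minimizer the gradient vanishes, so strong convexity gives
  \<open>\<mu>/2 * d(x, x*)\<^sup>2 \<le> F x - F x*\<close>. Hence an output of the given algorithm for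
  radius \<open>r\<close>, whose gap is at most \<open>\<mu> * r\<^sup>2 / 4\<close>, lies within \<open>r / sqrt 2\<close> of the minimizer and
  may serve as the starting point of a call with that radius. Every such restart halves
  the guaranteed gap, so about \<open>log\<^sub>2 (\<mu> * R\<^sup>2 / \<epsilon>)\<close> restarts suffice. A call takes at least one
  time unit, so the bookkeeping between calls only costs a constant factor.
\<close>

section \<open>Symmetry of the Riemannian distance\<close>

lemma has_vector_derivative_reverse:
  fixes f :: "real \<Rightarrow> 'a::real_normed_vector"
  assumes "(f has_vector_derivative v) (at (1 - t) within {1 - b..1 - a})"
  shows "((\<lambda>s. f (1 - s)) has_vector_derivative - v) (at t within {a..b})"
proof -
  have *: "((\<lambda>s. 1 - s) has_vector_derivative - 1) (at t within {a..b})"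
    by (auto intro!: derivative_eq_intros)
  have "(\<lambda>s. 1 - s) ` {a..b} = {1 - b..1 - a}"
    by simp
  with vector_diff_chain_within[OF *, of f v] assms show ?thesis
    by (simp add: o_def)
qed

text \<open>Reversal is an involution, so both directions are instances of the preceding
  rule.\<close>

lemma has_vector_derivative_reverse_iff:
  fixes f :: "real \<Rightarrow> 'a::real_normed_vector"
  shows "((\<lambda>s. f (1 - s)) has_vector_derivative v) (at t within {a..b}) \<longleftrightarrow>
    (f has_vector_derivative - v) (at (1 - t) within {1 - b..1 - a})"
  using has_vector_derivative_reverse[of f "- v" t b a]
    has_vector_derivative_reverse[of "\<lambda>s. f (1 - s)" v "1 - t" "1 - a" "1 - b"]
  by auto

text \<open>Derivatives within a nondegenerate interval are unique, endpoints included, so the value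
  from the chain rule is the one that \<open>vector_derivative\<close> selects.\<close>

lemma vector_derivative_reverse:
  fixes f :: "real \<Rightarrow> 'a::real_normed_vector"
  assumes "a < b" "t \<in> {a..b}" "f differentiable (at (1 - t) within {1 - b..1 - a})"
  shows "vector_derivative (\<lambda>s. f (1 - s)) (at t within {a..b}) =
    - vector_derivative f (at (1 - t) within {1 - b..1 - a})"
proof -
  have "(f has_vector_derivative vector_derivative f (at (1 - t) within {1 - b..1 - a}))
      (at (1 - t) within {1 - b..1 - a})"
    using assms(3) by (simp add: vector_derivative_works)
  from has_vector_derivative_reverse[OF this] show ?thesis
    using vector_derivative_within_cbox[of a b t] assms(1,2) by simp
qed

text \<open>Where the curve is not differentiable, \<open>vector_derivative\<close> is the same junk value on both sides.\<close>

lemma vector_derivative_reverse_cases: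
  fixes f :: "real \<Rightarrow> 'a::real_normed_vector"
  assumes "a < b" "t \<in> {a..b}"
  defines "v \<equiv> vector_derivative f (at (1 - t) within {1 - b..1 - a})"
  shows "vector_derivative (\<lambda>s. f (1 - s)) (at t within {a..b}) \<in> {v, - v}"
proof (cases "f differentiable (at (1 - t) within {1 - b..1 - a})")
  case True
  then show ?thesis
    using vector_derivative_reverse[OF assms(1,2) True] by (simp add: v_def)
next
  case False
  then have *: "\<not> (f has_vector_derivative w) (at (1 - t) within {1 - b..1 - a})" for w
    using differentiableI_vector by blast
  then have "\<not> ((\<lambda>s. f (1 - s)) has_vector_derivative w) (at t within {a..b})" for w
    by (simp add: has_vector_derivative_reverse_iff)
  with * have "vector_derivative (\<lambda>s. f (1 - s)) (at t within {a..b}) = v"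
    by (simp add: vector_derivative_def v_def)
  then show ?thesis
    by simp
qed

lemma c1_curve_reverse:
  assumes "c1_curve A \<gamma> (1 - b) (1 - a)" "a < b"
  shows "c1_curve A (\<lambda>t. \<gamma> (1 - t)) a b"
proof -
  let ?I = "{a..b}" and ?J = "{1 - b..1 - a}"
  have cont: "continuous_on ?J \<gamma>"
    and diff: "\<And>c t. c \<in> A \<Longrightarrow> t \<in> ?J \<Longrightarrow> \<gamma> t \<in> fst c \<Longrightarrow>
      (snd c \<circ> \<gamma>) differentiable (at t within ?J)"
    and cder: "\<And>c. c \<in> A \<Longrightarrow> continuous_on {t\<in>?J. \<gamma> t \<in> fst c}
      (\<lambda>t. vector_derivative (snd c \<circ> \<gamma>) (at t within ?J))"
    using assms(1) unfolding c1_curve_def by blast+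
  have 1: "continuous_on ?I (\<lambda>t. \<gamma> (1 - t))"
    by (rule continuous_on_compose2[OF cont]) (auto intro!: continuous_intros)
  have 2: "(snd c \<circ> (\<lambda>t. \<gamma> (1 - t))) differentiable (at t within ?I)"
    if "c \<in> A" "t \<in> ?I" "\<gamma> (1 - t) \<in> fst c" for c t
  proof -
    have "1 - t \<in> ?J"
      using that by simp
    from diff[OF that(1) this that(3)] obtain v where
      "((snd c \<circ> \<gamma>) has_vector_derivative v) (at (1 - t) within ?J)"
      by (auto simp: vector_derivative_works)
    from has_vector_derivative_reverse[OF this] show ?thesis
      by (simp add: o_def differentiableI_vector)
  qed
  have 3: "continuous_on {t\<in>?I. \<gamma> (1 - t) \<in> fst c}
      (\<lambda>t. vector_derivative (snd c \<circ> (\<lambda>t. \<gamma> (1 - t))) (at t within ?I))" if "c \<in> A" for c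
  proof -
    have "continuous_on {t\<in>?I. \<gamma> (1 - t) \<in> fst c}
        (\<lambda>t. - vector_derivative (snd c \<circ> \<gamma>) (at (1 - t) within ?J))"
      by (intro continuous_on_minus continuous_on_compose2[OF cder[OF that]])
        (auto intro!: continuous_intros)
    moreover have "vector_derivative (snd c \<circ> (\<lambda>t. \<gamma> (1 - t))) (at t within ?I) =
        - vector_derivative (snd c \<circ> \<gamma>) (at (1 - t) within ?J)"
      if t: "t \<in> ?I" "\<gamma> (1 - t) \<in> fst c" for t
      using vector_derivative_reverse[of a b t "snd c \<circ> \<gamma>"] diff[OF \<open>c \<in> A\<close>, of "1 - t"] assms(2) t
      by (simp add: o_def)
    ultimately show ?thesis
      by (subst continuous_on_cong[OF refl]) auto
  qed
  show ?thesis
    using 1 2 3 unfolding c1_curve_def by blast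
qed

lemma piecewise_c1_curve_reverse:
  assumes "piecewise_c1_curve A \<gamma>"
  shows "piecewise_c1_curve A (\<lambda>t. \<gamma> (1 - t))"
proof -
  obtain S where S: "finite S" "{0, 1} \<subseteq> S" "S \<subseteq> {0..1}"
    and c1: "\<And>a b. a \<in> S \<Longrightarrow> b \<in> S \<Longrightarrow> a < b \<Longrightarrow> S \<inter> {a<..<b} = {} \<Longrightarrow> c1_curve A \<gamma> a b"
    using assms unfolding piecewise_c1_curve_def by metis
  \<comment> \<open>Consecutive breakpoints \<open>a < b\<close> of the reflected set come from
    consecutive breakpoints \<open>1 - b < 1 - a\<close> of \<open>S\<close>.\<close>
  let ?S = "(\<lambda>t. 1 - t) ` S"
  have "c1_curve A (\<lambda>t. \<gamma> (1 - t)) a b"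
    if "a \<in> ?S" "b \<in> ?S" "a < b" "?S \<inter> {a<..<b} = {}" for a b
  proof (rule c1_curve_reverse[OF c1 \<open>a < b\<close>])
    show "1 - b \<in> S" "1 - a \<in> S" "1 - b < 1 - a"
      using that by auto
    show "S \<inter> {1 - b<..<1 - a} = {}"
    proof (rule ccontr)
      assume "S \<inter> {1 - b<..<1 - a} \<noteq> {}"
      then obtain s where "s \<in> S" "1 - b < s" "s < 1 - a"
        by auto
      then have "1 - s \<in> ?S \<inter> {a<..<b}"
        by auto
      with that(4) show False
        by blast
    qed
  qed
  moreover have "finite ?S" "{0, 1} \<subseteq> ?S" "?S \<subseteq> {0..1}"
    using S by force+
  ultimately show ?thesis
    unfolding piecewise_c1_curve_def by blast
qed

section \<open>Tangent vectors and differentials in charts\<close>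

context smooth_manifold
begin

lemma chart_at: "chart_at A p \<in> A" "p \<in> fst (chart_at A p)"
proof -
  have "\<exists>c. c \<in> A \<and> p \<in> fst c"
    using charts_cover by blast
  from someI_ex[OF this] show "chart_at A p \<in> A" "p \<in> fst (chart_at A p)"
    by (auto simp: chart_at_def)
qed

lemma chart_inv_chart: "c \<in> A \<Longrightarrow> p \<in> fst c \<Longrightarrow> chart_inv c (snd c p) = p"
  using chart_homeomorphism homeomorphism_apply1 by blast

lemma linear_transition_deriv:
  assumes "c \<in> A" "c' \<in> A" "p \<in> fst c" "p \<in> fst c'"
  shows "linear (transition_deriv c c' p)"
proof -
  have "Ck_on (Suc 0) (snd c ` (fst c \<inter> fst c')) (transition c c')"
    using charts_compatible[OF assms(1,2)] unfolding smooth_on_def by blast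
  then have "transition c c' differentiable (at (snd c p))"
    using assms by auto
  then show ?thesis
    unfolding transition_deriv_def by (rule linear_frechet_derivative)
qed

lemma zero_in_tangent_space: "(\<lambda>_. 0) \<in> tangent_space A p"
  by (auto simp: tangent_space_def linear_0[OF linear_transition_deriv])

text \<open>The coordinates in one chart determine a tangent vector, through transition derivatives
  that are linear.\<close>

lemma tangent_eq_zero:
  assumes "v \<in> tangent_space A p" "v (chart_at A p) = 0"
  shows "v = (\<lambda>_. 0)"
proof
  fix c
  show "v c = 0"
  proof (cases "c \<in> A \<and> p \<in> fst c")
    case True
    then have "v c = transition_deriv (chart_at A p) c p (v (chart_at A p))"
      using assms(1) chart_at unfolding tangent_space_def by blast
    then show ?thesis
      using True assms(2) linear_0[OF linear_transition_deriv[OF chart_at(1) _ chart_at(2)]] by simp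
  next
    case False
    then show ?thesis
      using assms(1) unfolding tangent_space_def by blast
  qed
qed

lemma differential_minimizer:
  assumes "differentiable_fun A F" "minimizer F p"
  shows "differential A F p v = 0"
proof -
  define c where "c = chart_at A p"
  have c: "c \<in> A" "p \<in> fst c"
    using chart_at by (simp_all add: c_def)
  have "(F \<circ> chart_inv c) differentiable (at (snd c p))"
    using assms(1) c unfolding differentiable_fun_def by blast
  then have "((F \<circ> chart_inv c) has_derivative
      frechet_derivative (F \<circ> chart_inv c) (at (snd c p))) (at (snd c p))"
    using frechet_derivative_works by blast
  \<comment> \<open>The minimum is global, so the inequality holds for every \<open>u\<close>, even
    outside the chart image where \<open>chart_inv c u\<close> is arbitrary. Hence
    \<open>UNIV\<close> can serve as the open set in Fermat's rule.\<close>
  moreover have "(F \<circ> chart_inv c) (snd c p) \<le> (F \<circ> chart_inv c) u" for u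
    using assms(2) c by (simp add: chart_inv_chart minimizer_def)
  ultimately have "frechet_derivative (F \<circ> chart_inv c) (at (snd c p)) = (\<lambda>_. 0)"
    using differential_zero_maxmin[of "snd c p" UNIV] by auto
  then show ?thesis
    by (simp add: differential_def flip: c_def)
qed

end

section \<open>Lengths of reversed curves\<close>

context riemannian_manifold
begin

lemma bilinear_at: "bilinear (g (chart_at A p) p)"
  by (intro metric_bilinear chart_at)

text \<open>The norm reads a single chart and is even. This covers both outcomes of
  \<open>vector_derivative_reverse_cases\<close>, so reversal keeps the speed at every time.\<close>

lemma norm_at_cong_sign:
  assumes "v (chart_at A p) \<in> {w (chart_at A p), - w (chart_at A p)}"
  shows "norm_at A g p v = norm_at A g p w"
  using assms bilinear_lneg[OF bilinear_at] bilinear_rneg[OF bilinear_at]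
  by (auto simp: norm_at_def inner_at_def)

lemma curve_length_reverse: "curve_length A g (\<lambda>t. \<gamma> (1 - t)) = curve_length A g \<gamma>"
proof -
  define f where "f t = norm_at A g (\<gamma> t) (velocity A \<gamma> {0..1} t)" for t
  have "norm_at A g (\<gamma> (1 - t)) (velocity A (\<lambda>t. \<gamma> (1 - t)) {0..1} t) = f (1 - t)"
    if "t \<in> {0..1}" for t
    unfolding f_def
  proof (rule norm_at_cong_sign)
    show "velocity A (\<lambda>t. \<gamma> (1 - t)) {0..1} t (chart_at A (\<gamma> (1 - t)))
        \<in> {velocity A \<gamma> {0..1} (1 - t) (chart_at A (\<gamma> (1 - t))),
           - velocity A \<gamma> {0..1} (1 - t) (chart_at A (\<gamma> (1 - t)))}"
      using vector_derivative_reverse_cases[of 0 1 t "snd (chart_at A (\<gamma> (1 - t))) \<circ> \<gamma>"] that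
      by (simp add: velocity_def o_def)
  qed
  then have "curve_length A g (\<lambda>t. \<gamma> (1 - t)) = integral {0..1} (\<lambda>t. f (1 - t))"
    unfolding curve_length_def by (intro integral_cong) simp
  \<comment> \<open>The substitution is a reflection about 0 followed by a shift by 1, and is valid
    for arbitrary \<open>f\<close>, integrable or not.\<close>
  also have "\<dots> = integral {0..1} f"
    using Henstock_Kurzweil_Integration.integral_reflect_real[of 1 0 "\<lambda>t. f (1 + t)"]
      integral_shift_Icc_real[of "- 1" 0 f 1]
      Henstock_Kurzweil_Integration.integral_reflect_real[of 0 "- 1" "\<lambda>t. f (1 + t)"]
    by (simp add: o_def)
  also have "\<dots> = curve_length A g \<gamma>"
    by (simp add: curve_length_def f_def[abs_def])
  finally show ?thesis .
qed

text \<open>Reversing curves gives one inclusion between the sets of lengths, and exchanging the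
  endpoints gives the other. It is needed because strong convexity at \<open>xstar\<close> measures
  distance from \<open>xstar\<close>, whereas the algorithm is promised a bound on the distance to
  it.\<close>

lemma riem_dist_sym: "riem_dist A g x y = riem_dist A g y x"
proof -
  have "{curve_length A g \<gamma> |\<gamma>. piecewise_c1_curve A \<gamma> \<and> \<gamma> 0 = x \<and> \<gamma> 1 = y} \<subseteq>
    {curve_length A g \<gamma> |\<gamma>. piecewise_c1_curve A \<gamma> \<and> \<gamma> 0 = y \<and> \<gamma> 1 = x}" for x y
  proof clarify
    fix \<gamma> :: "real \<Rightarrow> 'm"
    assume "piecewise_c1_curve A \<gamma>"
    then show "\<exists>\<eta>. curve_length A g \<gamma> = curve_length A g \<eta> \<and> piecewise_c1_curve A \<eta> \<and>
        \<eta> 0 = \<gamma> 1 \<and> \<eta> 1 = \<gamma> 0"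
      by (intro exI[of _ "\<lambda>t. \<gamma> (1 - t)"])
        (simp add: curve_length_reverse piecewise_c1_curve_reverse)
  qed
  then show ?thesis
    unfolding riem_dist_def by (metis (no_types, lifting) subset_antisym)
qed

section \<open>Quadratic growth at the minimizer\<close>

text \<open>The zero vector represents the vanishing differential. Any other candidate, tested
  against itself, has norm zero, so positive definiteness makes the description unique.\<close>

lemma gradient_minimizer:
  assumes "differentiable_fun A F" "minimizer F p"
  shows "gradient A g F p = (\<lambda>_. 0)"
  unfolding gradient_def
proof (rule the_equality)
  show "(\<lambda>_. 0) \<in> tangent_space A p \<and>
      (\<forall>w\<in>tangent_space A p. inner_at A g p (\<lambda>_. 0) w = differential A F p w)"
    using zero_in_tangent_space differential_minimizer[OF assms]
    by (simp add: inner_at_def bilinear_lzero[OF bilinear_at])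
next
  fix v
  assume v: "v \<in> tangent_space A p \<and>
    (\<forall>w\<in>tangent_space A p. inner_at A g p v w = differential A F p w)"
  then have "inner_at A g p v v = 0"
    using differential_minimizer[OF assms] by simp
  then have "v (chart_at A p) = 0"
    using metric_pos[OF chart_at(1) chart_at(2)[of p], of "v (chart_at A p)"] by (force simp: inner_at_def)
  with v show "v = (\<lambda>_. 0)"
    using tangent_eq_zero by blast
qed

lemma strongly_g_convex_quadratic_growth:
  assumes "strongly_g_convex A g \<mu> F" "minimizer F xstar"
  shows "\<mu> / 2 * (riem_dist A g x xstar)\<^sup>2 \<le> F x - F xstar"
proof -
  have "differentiable_fun A F"
    and le: "F xstar + inner_at A g xstar (gradient A g F xstar) (exp_inv A g xstar x)
      + \<mu> / 2 * (riem_dist A g xstar x)\<^sup>2 \<le> F x"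
    using assms(1) unfolding strongly_g_convex_def by auto
  then have "inner_at A g xstar (gradient A g F xstar) (exp_inv A g xstar x) = 0"
    using assms(2) by (simp add: gradient_minimizer inner_at_def bilinear_lzero[OF bilinear_at])
  with le show ?thesis
    by (simp add: riem_dist_sym)
qed

end

section \<open>The restarted algorithm\<close>

lemma exec_time_pos: "exec sem orc c s t s' \<Longrightarrow> 1 \<le> t"
  by (induction rule: exec.induct) auto

text \<open>Real registers \<open>0\<close> to \<open>3\<close> hold the inputs \<open>L\<close>, \<open>\<mu>\<close>, \<open>r\<close>, \<open>\<epsilon>\<close>, register \<open>4\<close> the gap
  guaranteed by the last call, and registers \<open>5\<close> and \<open>6\<close> the constants \<open>1 / 4\<close> and \<open>1 / sqrt 2\<close>.\<close>

definition restart_body :: "'o com \<Rightarrow> 'o com" where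
  "restart_body c = Seq (Call c [0, 1, 2] 0 0)
     (Seq (Arith Mul 4 2 2) (Seq (Arith Mul 4 1 4) (Seq (Arith Mul 4 4 5) (Arith Mul 2 2 6))))"

text \<open>One run of the body precedes the loop, so that register \<open>4\<close> holds a
  guaranteed gap when it is first compared with \<epsilon> in register \<open>3\<close>.\<close>

definition restart :: "'o com \<Rightarrow> 'o com" where
  "restart c = Seq (Const 5 (1 / 4)) (Seq (Const 6 (sqrt (1 / 2)))
     (Seq (restart_body c) (WhileLess 3 4 (restart_body c))))"

lemma exec_restart_body:
  assumes "exec sem orc c (init_memory [rreg s 0, rreg s 1, rreg s 2] (preg s 0)) t s1"
  obtains s' where "exec sem orc (restart_body c) s (8 + t) s'"
    "rreg s' = (rreg s)(4 := rreg s 1 * (rreg s 2 * rreg s 2) * rreg s 5, 2 := rreg s 2 * rreg s 6)"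
    "preg s' 0 = preg s1 0"
proof -
  let ?s1 = "s\<lparr>preg := (preg s)(0 := preg s1 0)\<rparr>"
  have "exec sem orc (Call c [0, 1, 2] 0 0) s (1 + length [0::nat, 1, 2] + t) ?s1"
    by (rule exec_Call) (use assms in simp)
  note exec = exec_Seq[OF this exec_Seq[OF exec_Arith exec_Seq[OF exec_Arith
      exec_Seq[OF exec_Arith exec_Arith]]],
      of Mul 4 2 2 Mul 4 1 4 Mul 4 4 5 Mul 2 2 6, folded restart_body_def]
  \<comment> \<open>The overhead is 1 for the call, 3 for its real arguments and 4 for the
    arithmetic.\<close>
  have time: "1 + length [0::nat, 1, 2] + t + (1 + (1 + (1 + 1))) = 8 + t"
    by simp
  show thesis
    by (rule that[OF exec[unfolded time]]) (simp_all add: fun_eq_iff)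
qed

section \<open>Invariant, correctness and cost of the restarts\<close>

context riemannian_manifold
begin

context
  fixes sem :: "'o \<Rightarrow> ('m, 'e) memory \<Rightarrow> ('m, 'e) memory"
    and F :: "'m \<Rightarrow> real" and xstar :: 'm and c :: "'o com" and L \<mu> R T \<epsilon> :: real
  assumes convex: "strongly_g_convex A g \<mu> F" and minimizer: "minimizer F xstar"
    and solves: "\<And>r. 0 < r \<Longrightarrow> r \<le> R \<Longrightarrow> solves_task A g sem F xstar c L \<mu> r T"
begin

text \<open>This is what the next call needs. Register \<open>4\<close> is left out because the
  invariant must already hold before the first call, which is what produces a guaranteed
  gap.\<close>

definition restart_inv :: "('m, 'e) memory \<Rightarrow> bool" where
  "restart_inv s \<longleftrightarrow> rreg s 0 = L \<and> rreg s 1 = \<mu> \<and> 0 < rreg s 2 \<and> rreg s 2 \<le> R \<and> rreg s 3 = \<epsilon> \<and>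
     rreg s 5 = 1 / 4 \<and> rreg s 6 = sqrt (1 / 2) \<and> riem_dist A g (preg s 0) xstar \<le> rreg s 2"

lemma riem_dist_le_of_gap:
  assumes "F x - F xstar \<le> \<mu> * r\<^sup>2 / 4" "0 \<le> r"
  shows "riem_dist A g x xstar \<le> r * sqrt (1 / 2)"
proof -
  have "\<mu> > 0"
    using convex by (simp add: strongly_g_convex_def)
  have "\<mu> / 2 * (riem_dist A g x xstar)\<^sup>2 \<le> \<mu> / 2 * (r * sqrt (1 / 2))\<^sup>2"
    using strongly_g_convex_quadratic_growth[OF convex minimizer, of x] assms(1)
    by (simp add: power_mult_distrib)
  then have "(riem_dist A g x xstar)\<^sup>2 \<le> (r * sqrt (1 / 2))\<^sup>2"
    using \<open>\<mu> > 0\<close> by simp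
  then show ?thesis
    by (rule power2_le_imp_le) (use assms(2) in simp)
qed

text \<open>Register \<open>4\<close> is described twice: through the old radius, which shows that
  the guarantee is halved, and through the new one, which is the form required at the next
  iteration.\<close>

lemma restart_body_step:
  assumes "restart_inv s"
  shows "\<exists>t s'. exec sem (first_order_oracle A g F) (restart_body c) s t s' \<and> real t \<le> 8 + T \<and>
    restart_inv s' \<and> rreg s' 4 = \<mu> * (rreg s 2)\<^sup>2 / 4 \<and> rreg s' 4 = \<mu> * (rreg s' 2)\<^sup>2 / 2 \<and>
    F (preg s' 0) - F xstar \<le> rreg s' 4"
proof -
  define r where "r = rreg s 2"
  have s: "rreg s 0 = L" "rreg s 1 = \<mu>" "0 < r" "r \<le> R" "rreg s 3 = \<epsilon>" "rreg s 5 = 1 / 4"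
    "rreg s 6 = sqrt (1 / 2)" "riem_dist A g (preg s 0) xstar \<le> r"
    using assms by (auto simp: restart_inv_def r_def)
  obtain t s1 where t: "exec sem (first_order_oracle A g F) c (init_memory [L, \<mu>, r] (preg s 0)) t s1"
      "real t \<le> T" and gap: "F (preg s1 0) - F xstar \<le> \<mu> * r\<^sup>2 / 4"
    using solves[OF s(3,4)] s(8) unfolding solves_task_def outputs_def by blast
  have "init_memory [rreg s 0, rreg s 1, rreg s 2] (preg s 0) = init_memory [L, \<mu>, r] (preg s 0)"
    using s by (simp add: r_def)
  from exec_restart_body[of sem "first_order_oracle A g F" c s t s1, unfolded this, OF t(1)]
  obtain s' where s': "exec sem (first_order_oracle A g F) (restart_body c) s (8 + t) s'"
      "rreg s' = (rreg s)(4 := \<mu> * (r * r) * (1 / 4), 2 := r * sqrt (1 / 2))"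
      "preg s' 0 = preg s1 0"
    unfolding s(2,6,7) r_def[symmetric] .
  have "riem_dist A g (preg s' 0) xstar \<le> r * sqrt (1 / 2)"
    using riem_dist_le_of_gap[OF gap] s(3) s'(3) by simp
  \<comment> \<open>The promise about the given algorithm covers only radii up to
    \<open>R\<close>.\<close>
  moreover have "r * sqrt (1 / 2) \<le> R"
  proof -
    have "r * sqrt (1 / 2) \<le> r * 1"
      using s(3) by (intro mult_left_mono) auto
    with s(4) show ?thesis
      by linarith
  qed
  ultimately have "restart_inv s'"
    using s s'(2) unfolding restart_inv_def by simp
  moreover have "rreg s' 4 = \<mu> * r\<^sup>2 / 4" "rreg s' 4 = \<mu> * (rreg s' 2)\<^sup>2 / 2"
    by (simp_all add: s'(2) power_mult_distrib flip: power2_eq_square)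
  moreover have "real (8 + t) \<le> 8 + T"
    using t(2) by simp
  ultimately show ?thesis
    using s'(1,3) gap unfolding r_def by metis
qed

text \<open>Register \<open>2\<close> already holds the radius of the next call, hence \<open>\<mu> * r\<^sup>2 / 2\<close> for the gap
  guaranteed by the last one.\<close>

lemma restart_while:
  assumes "restart_inv s" "rreg s 4 = \<mu> * (rreg s 2)\<^sup>2 / 2" "F (preg s 0) - F xstar \<le> rreg s 4"
    "rreg s 4 \<le> \<epsilon> * 2 ^ k" "0 \<le> T"
  shows "\<exists>t s'. exec sem (first_order_oracle A g F) (WhileLess 3 4 (restart_body c)) s t s' \<and>
    real t \<le> 1 + real k * (9 + T) \<and> F (preg s' 0) - F xstar \<le> \<epsilon>"
  using assms
proof (induction k arbitrary: s)
  case (0 s)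
  then have "\<not> rreg s 3 < rreg s 4" "F (preg s 0) - F xstar \<le> \<epsilon>"
    by (auto simp: restart_inv_def)
  then show ?case
    using exec_WhileFalse[of s 3 4] by fastforce
next
  case (Suc k s)
  have eps: "rreg s 3 = \<epsilon>"
    using Suc.prems(1) by (simp add: restart_inv_def)
  show ?case
  proof (cases "rreg s 3 < rreg s 4")
    case False
    then have "F (preg s 0) - F xstar \<le> \<epsilon>"
      using Suc.prems(3) eps by simp
    moreover have "real 1 \<le> 1 + real (Suc k) * (9 + T)"
      using \<open>0 \<le> T\<close> by simp
    ultimately show ?thesis
      using exec_WhileFalse[OF False] by blast
  next
    case True
    obtain t s' where s': "exec sem (first_order_oracle A g F) (restart_body c) s t s'"
        "real t \<le> 8 + T" "restart_inv s'" "rreg s' 4 = \<mu> * (rreg s 2)\<^sup>2 / 4"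
        "rreg s' 4 = \<mu> * (rreg s' 2)\<^sup>2 / 2" "F (preg s' 0) - F xstar \<le> rreg s' 4"
      using restart_body_step[OF Suc.prems(1)] by blast
    \<comment> \<open>The old value is \<open>\<mu> * (rreg s 2)\<^sup>2 / 2\<close>, twice the new
      one, so one factor 2 is spent.\<close>
    have "rreg s' 4 \<le> \<epsilon> * 2 ^ k"
      using Suc.prems(2,4) s'(4) by simp
    from Suc.IH[OF s'(3,5,6) this \<open>0 \<le> T\<close>] obtain u s'' where
      s'': "exec sem (first_order_oracle A g F) (WhileLess 3 4 (restart_body c)) s' u s''"
        "real u \<le> 1 + real k * (9 + T)" "F (preg s'' 0) - F xstar \<le> \<epsilon>"
      by blast
    \<comment> \<open>An iteration costs one test plus at most \<open>8 + T\<close>; the leading 1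
      pays for the final failing test.\<close>
    have "real (1 + t + u) \<le> 1 + real (Suc k) * (9 + T)"
      using s'(2) s''(2) by (simp add: algebra_simps)
    then show ?thesis
      using exec_WhileTrue[OF True s'(1) s''(1)] s''(3) by blast
  qed
qed

text \<open>A run from \<open>x0\<close> with radius \<open>R\<close> exists and takes at least one
  step. This lets multiples of \<open>T\<close> absorb the additive overhead.\<close>

lemma restart_time_ge_1:
  assumes "0 < R" "riem_dist A g x0 xstar \<le> R"
  shows "1 \<le> T"
proof -
  obtain t xT where "outputs A g sem F c [L, \<mu>, R] x0 t xT" "real t \<le> T"
    using solves[OF \<open>0 < R\<close>] assms unfolding solves_task_def by blast
  then show ?thesis
    by (auto simp: outputs_def dest: exec_time_pos)
qed

lemma restart_outputs:
  assumes "0 < R" "riem_dist A g x0 xstar \<le> R" "\<mu> * R\<^sup>2 / 4 \<le> \<epsilon> * 2 ^ k"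
  shows "\<exists>t xhat. outputs A g sem F (restart c) [L, \<mu>, R, \<epsilon>] x0 t xhat \<and>
    eps_minimizer F xstar \<epsilon> xhat \<and> real t \<le> T * (12 + 10 * real k)"
proof -
  have "1 \<le> T"
    using restart_time_ge_1[OF assms(1,2)] .
  define s0 :: "('m, 'e) memory" where "s0 = init_memory [L, \<mu>, R, \<epsilon>] x0"
  define s1 where "s1 = s0\<lparr>rreg := (rreg s0)(5 := 1 / 4)\<rparr>"
  define s2 where "s2 = s1\<lparr>rreg := (rreg s1)(6 := sqrt (1 / 2))\<rparr>"
  have "restart_inv s2" and R: "rreg s2 2 = R"
    using assms(1,2) by (auto simp: restart_inv_def s2_def s1_def s0_def init_memory_def)
  from restart_body_step[OF this(1)] obtain t s' where
    s': "exec sem (first_order_oracle A g F) (restart_body c) s2 t s'"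
      "real t \<le> 8 + T" "restart_inv s'" "rreg s' 4 = \<mu> * R\<^sup>2 / 4"
      "rreg s' 4 = \<mu> * (rreg s' 2)\<^sup>2 / 2" "F (preg s' 0) - F xstar \<le> rreg s' 4"
    unfolding R by blast
  have "rreg s' 4 \<le> \<epsilon> * 2 ^ k" "0 \<le> T"
    using assms(3) s'(4) \<open>1 \<le> T\<close> by simp_all
  from restart_while[OF s'(3,5,6) this] obtain u s'' where
    s'': "exec sem (first_order_oracle A g F) (WhileLess 3 4 (restart_body c)) s' u s''"
      "real u \<le> 1 + real k * (9 + T)" "F (preg s'' 0) - F xstar \<le> \<epsilon>"
    by blast
  have "exec sem (first_order_oracle A g F) (restart c) s0 (1 + (1 + (t + u))) s''"
    unfolding restart_def
  proof (intro exec_Seq)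
    show "exec sem (first_order_oracle A g F) (Const 5 (1 / 4)) s0 1 s1"
      unfolding s1_def by (rule exec_Const)
    show "exec sem (first_order_oracle A g F) (Const 6 (sqrt (1 / 2))) s1 1 s2"
      unfolding s2_def by (rule exec_Const)
  qed (use s'(1) s''(1) in auto)
  moreover have "real (1 + (1 + (t + u))) \<le> T * (12 + 10 * real k)"
  proof -
    \<comment> \<open>The 11 collects two constants, the overhead 8 of the first body and the last
      test. With \<open>1 \<le> T\<close> the two summands become at most \<open>12 * T\<close> and
      \<open>k * (10 * T)\<close>.\<close>
    have "real (1 + (1 + (t + u))) \<le> (11 + T) + real k * (9 + T)"
      using s'(2) s''(2) by simp
    also have "\<dots> \<le> 12 * T + real k * (10 * T)"
      using \<open>1 \<le> T\<close> by (intro add_mono mult_left_mono) auto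
    finally show ?thesis
      by (simp add: algebra_simps)
  qed
  ultimately show ?thesis
    using s''(3) unfolding outputs_def eps_minimizer_def s0_def by blast
qed

end

end

section \<open>Number of restarts against the logarithm of the condition
  \<open>q = \<mu> / \<epsilon>\<close>\<close>

lemma restart_count_bound:
  fixes q R :: real
  assumes "exp 1 \<le> q" "R\<^sup>2 \<le> q"
  shows "12 + 10 * real (nat \<lceil>log 2 (q * R\<^sup>2 / 4)\<rceil>) \<le> 62 * ln q"
\<comment> \<open>For \<open>R = 0\<close> the convention \<open>log 2 0 = 0\<close> makes the count
  zero; the comparison of logarithms below needs positive arguments.\<close>
proof (cases "R = 0")
  case True
  have "1 \<le> ln q"
    using assms(1) by (meson exp_gt_zero less_le_trans ln_ge_iff)
  with True show ?thesis
    by (simp add: log_def)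
next
  case False
  have "0 < q"
    using assms(1) by (meson exp_gt_zero less_le_trans)
  then have "1 \<le> ln q"
    using assms(1) by (simp add: ln_ge_iff)
  \<comment> \<open>Here \<open>R\<^sup>2 \<le> q\<close> removes the radius at the price of a
    factor 2 in the logarithm; \<open>ln 2 \<ge> 1 / 2\<close> costs another.\<close>
  have "q * R\<^sup>2 / 4 \<le> q ^ 2"
    using assms(2) \<open>0 < q\<close> mult_left_mono[of "R\<^sup>2" q q] by (simp add: power2_eq_square)
  then have "log 2 (q * R\<^sup>2 / 4) \<le> log 2 (q ^ 2)"
    using \<open>0 < q\<close> False by (subst log_le_cancel_iff) auto
  also have "\<dots> = 2 * (ln q / ln 2)"
    using \<open>0 < q\<close> by (simp add: log_def ln_realpow)
  also have "\<dots> \<le> 2 * (2 * ln q)"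
  proof -
    have "1 / 2 \<le> ln (2::real)"
      using ln2_ge_two_thirds by simp
    then have "1 * ln q \<le> (2 * ln 2) * ln q"
      using \<open>1 \<le> ln q\<close> by (intro mult_right_mono) auto
    then show ?thesis
      by (simp add: field_simps)
  qed
  finally have "log 2 (q * R\<^sup>2 / 4) \<le> 4 * ln q"
    by simp
  \<comment> \<open>Rounding up adds 1, so the total is at most \<open>22 + 40 * ln q\<close>, and
    \<open>1 \<le> ln q\<close> turns this into \<open>62 * ln q\<close>.\<close>
  then have "real (nat \<lceil>log 2 (q * R\<^sup>2 / 4)\<rceil>) \<le> 1 + 4 * ln q"
    using \<open>1 \<le> ln q\<close> by linarith
  with \<open>1 \<le> ln q\<close> show ?thesis
    by simp
qed

theorem theorem8:
  shows "\<exists>(C::real) (N::real \<Rightarrow> real). C > 0 \<and>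
    (\<forall>(A :: ('m::{t2_space, second_countable_topology}, 'e::euclidean_space) chart set)
       (g :: ('m, 'e) metric)
       (sem :: 'o \<Rightarrow> ('m, 'e) memory \<Rightarrow> ('m, 'e) memory)
       (Ans :: 'o com).
      riemannian_manifold A g \<longrightarrow> uniquely_geodesic A g \<longrightarrow>
      (\<exists>(Alg :: 'o com).
        \<forall>(F :: 'm \<Rightarrow> real) (L::real) (\<mu>::real) (R::real) (xstar :: 'm)
          (Time_ns :: real \<Rightarrow> real \<Rightarrow> real \<Rightarrow> real).
          L_smooth A g L F \<longrightarrow> strongly_g_convex A g \<mu> F \<longrightarrow> minimizer F xstar \<longrightarrow> R > 0 \<longrightarrow>
          mono_on {0<..R} (Time_ns L \<mu>) \<longrightarrow>
          (\<forall>r\<in>{0<..R}. solves_task A g sem F xstar Ans L \<mu> r (Time_ns L \<mu> r)) \<longrightarrow>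
          (\<forall>\<epsilon>>0. \<forall>x0. riem_dist A g x0 xstar \<le> R \<longrightarrow>
            (\<exists>t xhat. outputs A g sem F Alg [L, \<mu>, R, \<epsilon>] x0 t xhat \<and>
               eps_minimizer F xstar \<epsilon> xhat \<and>
               (\<mu> / \<epsilon> \<ge> N R \<longrightarrow> real t \<le> C * (Time_ns L \<mu> R * ln (\<mu> / \<epsilon>)))))))"
\<comment> \<open>Both witnesses come from \<open>restart_count_bound\<close>: beyond
  \<open>exp 1\<close> the logarithm is at least 1, and beyond \<open>R\<^sup>2\<close> it absorbs
  the radius.\<close>
proof (intro exI[of _ "62 :: real"] exI[of _ "\<lambda>R. max (exp 1) (R\<^sup>2)"] conjI allI impI)
  fix A :: "('m, 'e) chart set" and g :: "('m, 'e) metric"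
    and sem :: "'o \<Rightarrow> ('m, 'e) memory \<Rightarrow> ('m, 'e) memory" and Ans :: "'o com"
  assume "riemannian_manifold A g"
  then interpret riemannian_manifold A g .
  show "\<exists>(Alg :: 'o com).
        \<forall>(F :: 'm \<Rightarrow> real) (L::real) (\<mu>::real) (R::real) (xstar :: 'm)
          (Time_ns :: real \<Rightarrow> real \<Rightarrow> real \<Rightarrow> real).
          L_smooth A g L F \<longrightarrow> strongly_g_convex A g \<mu> F \<longrightarrow> minimizer F xstar \<longrightarrow> R > 0 \<longrightarrow>
          mono_on {0<..R} (Time_ns L \<mu>) \<longrightarrow>
          (\<forall>r\<in>{0<..R}. solves_task A g sem F xstar Ans L \<mu> r (Time_ns L \<mu> r)) \<longrightarrow>
          (\<forall>\<epsilon>>0. \<forall>x0. riem_dist A g x0 xstar \<le> R \<longrightarrow>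
            (\<exists>t xhat. outputs A g sem F Alg [L, \<mu>, R, \<epsilon>] x0 t xhat \<and>
               eps_minimizer F xstar \<epsilon> xhat \<and>
               (\<mu> / \<epsilon> \<ge> max (exp 1) (R\<^sup>2) \<longrightarrow>
                 real t \<le> 62 * (Time_ns L \<mu> R * ln (\<mu> / \<epsilon>)))))"
  \<comment> \<open>The program depends on \<open>Ans\<close> alone; the parameters reach it as
    inputs and \<open>F\<close> through queries.\<close>
  proof (intro exI[of _ "restart Ans"] allI impI)
    fix F :: "'m \<Rightarrow> real" and L \<mu> R :: real and xstar :: 'm
      and Time_ns :: "real \<Rightarrow> real \<Rightarrow> real \<Rightarrow> real" and \<epsilon> :: real and x0 :: 'm
    assume convex: "strongly_g_convex A g \<mu> F" and minimizer: "minimizer F xstar"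
      and "R > 0" and mono: "mono_on {0<..R} (Time_ns L \<mu>)"
      and solves: "\<forall>r\<in>{0<..R}. solves_task A g sem F xstar Ans L \<mu> r (Time_ns L \<mu> r)"
      and "\<epsilon> > 0" and x0: "riem_dist A g x0 xstar \<le> R"
    define T where "T = Time_ns L \<mu> R"
    \<comment> \<open>The number of halvings that bring the first guarantee
      \<open>\<mu> * R\<^sup>2 / 4\<close> down to \<epsilon>; it is 0 if that is already small
      enough.\<close>
    define k where "k = nat \<lceil>log 2 (\<mu> / \<epsilon> * R\<^sup>2 / 4)\<rceil>"
    have "\<mu> > 0"
      using convex by (simp add: strongly_g_convex_def)
    \<comment> \<open>Monotonicity in the radius lets the single budget \<open>T\<close> serve every
      restart.\<close>
    have task: "solves_task A g sem F xstar Ans L \<mu> r T" if "0 < r" "r \<le> R" for r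
    proof -
      have "Time_ns L \<mu> r \<le> T"
        unfolding T_def using that mono by (auto intro: mono_onD)
      moreover have "solves_task A g sem F xstar Ans L \<mu> r (Time_ns L \<mu> r)"
        using solves that by simp
      ultimately show ?thesis
        unfolding solves_task_def by (meson order_trans)
    qed
    have "\<mu> / \<epsilon> * R\<^sup>2 / 4 \<le> 2 ^ k"
    proof -
      have "log 2 (\<mu> / \<epsilon> * R\<^sup>2 / 4) \<le> real k"
        unfolding k_def by linarith
      then show ?thesis
        using \<open>\<mu> > 0\<close> \<open>\<epsilon> > 0\<close> \<open>R > 0\<close> by (simp add: log_le_iff powr_realpow)
    qed
    then have "\<mu> * R\<^sup>2 / 4 \<le> \<epsilon> * 2 ^ k"
      using \<open>\<epsilon> > 0\<close> by (simp add: field_simps)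
    from restart_outputs[OF convex minimizer task \<open>R > 0\<close> x0 this]
    obtain t xhat where out: "outputs A g sem F (restart Ans) [L, \<mu>, R, \<epsilon>] x0 t xhat"
      "eps_minimizer F xstar \<epsilon> xhat" "real t \<le> T * (12 + 10 * real k)"
      by blast
    have "real t \<le> 62 * (T * ln (\<mu> / \<epsilon>))" if "max (exp 1) (R\<^sup>2) \<le> \<mu> / \<epsilon>"
    proof -
      have "1 \<le> T"
        using restart_time_ge_1[OF convex minimizer task \<open>R > 0\<close> x0] by blast
      then have "T * (12 + 10 * real k) \<le> T * (62 * ln (\<mu> / \<epsilon>))"
        using restart_count_bound[of "\<mu> / \<epsilon>" R] that
        unfolding k_def by (intro mult_left_mono) auto
      with out(3) show ?thesis
        by simp
    qed
    then show "\<exists>t xhat. outputs A g sem F (restart Ans) [L, \<mu>, R, \<epsilon>] x0 t xhat \<and>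
        eps_minimizer F xstar \<epsilon> xhat \<and>
        (\<mu> / \<epsilon> \<ge> max (exp 1) (R\<^sup>2) \<longrightarrow> real t \<le> 62 * (Time_ns L \<mu> R * ln (\<mu> / \<epsilon>)))"
      using out(1,2) unfolding T_def by blast
  qed
qed simp

end
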